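(* Let $p$ be a prime and $k\in\mathbb{N}$. Each of the following graphs has integral spectrum (all adjacency eigenvalues are integers): (a) $\Gamma\!\left(k\frac{q^{ta}-1}{q^t-1},\, q^{at}\right)$ for all $a,t\in\mathbb{N}$, where $q=p^k$, provided $k\mid p-1$; (b) $\Gamma\!\left(k\frac{q^{ta}-1}{q^t-1},\, q^{at}\right)$ for all $a,t\in\mathbb{N}$, where $q=p^2$, provided $k\mid p+1$; (c) $\Gamma\!\left(k\frac{q^{ta}-1}{q^t-1},\, q^{at}\right)$ for all $a,t\in\mathbb{N}$, where $q=p^{\varphi(k)}$, provided $\gcd(k,p(p-1))=1$; (d) $\Gamma\!\left(\Phi_d(p)\frac{q^{ta}-1}{q^t-1},\, q^{at}\right)$ for all $a,t\in\mathbb{N}$, where $q=p^d$ and $d>1$.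
   Context: For a prime power $Q$ and $k\in\mathbb{N}$, $R_k=\{x^k:x\in\mathbb{F}_Q^*\}$ and the generalized Paley graph $\Gamma(k,Q)$ has vertex set $\mathbb{F}_Q$ and an arc $x\to y$ iff $y-x\in R_k$. $\varphi$ is Euler's totient function and $\Phi_d(x)=\prod_{\omega}(x-\omega)$ is the $d$-th cyclotomic polynomial, the product over the primitive complex $d$-th roots of unity. *)

theory Defs
  imports
    Complex_Main
    "HOL-Algebra.Ring"
    "HOL-Number_Theory.Totient"
    "HOL-Computational_Algebra.Polynomial"
    "Graph_Theory.Pair_Digraph"
    "Jordan_Normal_Form.Spectral_Radius"
begin

definition kth_powers :: "('f, 'r) ring_scheme \<Rightarrow> nat \<Rightarrow> 'f set" where
  "kth_powers F k = {x [^]\<^bsub>F\<^esub> k | x. x \<in> carrier F - {\<zero>\<^bsub>F\<^esub>}}"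

text \<open>\<open>gen_paley k F\<close> is \<open>\<Gamma>(k, Q)\<close>, where the field \<open>F\<close> of order \<open>Q\<close> is passed itself in
  place of its order. It is a directed graph in general: \<open>R\<^sub>k\<close> need not be closed under negation.\<close>

definition gen_paley :: "nat \<Rightarrow> ('f, 'r) ring_scheme \<Rightarrow> 'f pair_pre_digraph" where
  "gen_paley k F =
    \<lparr> pverts = carrier F,
      parcs = {(x, y). x \<in> carrier F \<and> y \<in> carrier F \<and> y \<ominus>\<^bsub>F\<^esub> x \<in> kth_powers F k} \<rparr>"

definition adj_mat :: "'v pair_pre_digraph \<Rightarrow> 'v list \<Rightarrow> complex mat" where
  "adj_mat G vs =
    mat (length vs) (length vs) (\<lambda>(i, j). if (vs ! i, vs ! j) \<in> parcs G then 1 else 0)"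

text \<open>The matrices for different enumerations \<open>vs\<close> of the vertices are permutation-similar, so
  quantifying over all of them merely avoids choosing one. Eigenvalues are taken over the complex
  numbers, as the matrix need not be symmetric.\<close>

definition integral_spectrum :: "'v pair_pre_digraph \<Rightarrow> bool" where
  "integral_spectrum G \<longleftrightarrow> finite (pverts G) \<and>
    (\<forall>vs. distinct vs \<and> set vs = pverts G \<longrightarrow> spectrum (adj_mat G vs) \<subseteq> \<int>)"

definition primitive_roots_of_unity :: "nat \<Rightarrow> complex set" where
  "primitive_roots_of_unity d = {\<omega>. \<omega> ^ d = 1 \<and> (\<forall>j. 0 < j \<and> j < d \<longrightarrow> \<omega> ^ j \<noteq> 1)}"

definition cyclotomic_poly :: "nat \<Rightarrow> complex poly" where
  "cyclotomic_poly d = (\<Prod>\<omega>\<in>primitive_roots_of_unity d. [:-\<omega>, 1:])"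

end

theory Submission
  imports Defs "HOL-Algebra.Multiplicative_Group" "HOL-Algebra.AbelCoset" "HOL-Number_Theory.Residues"
begin

text \<open>In each case the exponent \<open>K\<close> satisfies \<open>K (p - 1) dvd Q - 1\<close>, so \<open>R\<^sub>K\<close> contains the nonzero
  elements of the prime field and is a disjoint union of sets \<open>L - {0}\<close> for lines \<open>L\<close> over that field.
  Hence the adjacency operator is \<open>\<Sum>\<^sub>L (P\<^sub>L - 1)\<close>, where \<open>P\<^sub>L f x = (\<Sum>h\<in>L. f (x + h))\<close>. The \<open>P\<^sub>L\<close> commute
  and satisfy \<open>P\<^sub>L\<^sup>2 = |L| P\<^sub>L\<close>, so every eigenspace of the adjacency operator contains a common
  eigenvector of all \<open>P\<^sub>L\<close>, on which each \<open>P\<^sub>L\<close> acts as \<open>0\<close> or \<open>|L|\<close>.\<close>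

section \<open>Sums over translates\<close>

text \<open>On a Cayley graph with connection set \<open>H\<close> this is the adjacency operator;
  for a finite subgroup \<open>H\<close> it is \<open>card H\<close> times the projection onto the
  \<open>H\<close>-invariant functions.\<close>

definition shift_sum :: "('a, 'r) ring_scheme \<Rightarrow> 'a set \<Rightarrow> ('a \<Rightarrow> complex) \<Rightarrow> 'a \<Rightarrow> complex"
  where "shift_sum G H f x = (\<Sum>h\<in>H. f (x \<oplus>\<^bsub>G\<^esub> h))"

context abelian_group
begin

lemma shift_sum_cong:
  assumes "\<And>y. y \<in> carrier G \<Longrightarrow> f y = g y" "H \<subseteq> carrier G" "x \<in> carrier G"
  shows "shift_sum G H f x = shift_sum G H g x"
  unfolding shift_sum_def using assms by (intro sum.cong) (auto intro!: assms(1))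

lemma shift_sum_scale: "shift_sum G H (\<lambda>y. c * f y) x = c * shift_sum G H f x"
  unfolding shift_sum_def by (simp add: sum_distrib_left)

lemma shift_sum_commute:
  assumes "H \<subseteq> carrier G" "K \<subseteq> carrier G" "x \<in> carrier G"
  shows "shift_sum G H (shift_sum G K f) x = shift_sum G K (shift_sum G H f) x"
proof -
  have "shift_sum G H (shift_sum G K f) x = (\<Sum>k\<in>K. \<Sum>h\<in>H. f (x \<oplus> h \<oplus> k))"
    unfolding shift_sum_def by (rule sum.swap)
  also have "\<dots> = shift_sum G K (shift_sum G H f) x"
    unfolding shift_sum_def using assms
    by (intro sum.cong refl arg_cong[of _ _ f]) (auto simp: subset_iff a_ac)
  finally show ?thesis .
qed

text \<open>Translation by an element of \<open>H\<close> permutes \<open>H\<close>, so the outer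
  sum repeats one value \<open>card H\<close> times.\<close>

lemma shift_sum_idem:
  assumes H: "additive_subgroup H G" and x: "x \<in> carrier G"
  shows "shift_sum G H (shift_sum G H f) x = of_nat (card H) * shift_sum G H f x"
proof -
  interpret H: additive_subgroup H G by (rule H)
  have *: "(\<Sum>k\<in>H. f (x \<oplus> h \<oplus> k)) = (\<Sum>k\<in>H. f (x \<oplus> k))" if h: "h \<in> H" for h
    using h x
    by (intro sum.reindex_bij_witness[of _ "\<lambda>k. \<ominus> h \<oplus> k" "\<lambda>k. h \<oplus> k"])
       (auto simp: r_neg2 r_neg1 a_assoc)
  show ?thesis unfolding shift_sum_def by (simp add: *)
qed

section \<open>Common eigenfunctions of commuting translate sums\<close>

text \<open>Subgroups are treated one at a time. If the sum over \<open>K\<close> kills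
  \<open>g\<close>, then \<open>g\<close> stays, with eigenvalue 0; otherwise \<open>g\<close> is
  replaced by its sum over \<open>K\<close>, which has eigenvalue \<open>card K\<close> because the
  operator is idempotent up to that factor. Commutation preserves all equations obtained earlier,
  including the one for \<open>S\<close>.\<close>

lemma common_eigenfunction:
  assumes "finite \<H>" and "\<And>H. H \<in> \<H> \<Longrightarrow> additive_subgroup H G" and S: "S \<subseteq> carrier G"
    and "\<exists>x\<in>carrier G. f x \<noteq> 0"
    and "\<And>x. x \<in> carrier G \<Longrightarrow> shift_sum G S f x = \<mu> * f x"
  shows "\<exists>g c. (\<exists>x\<in>carrier G. g x \<noteq> 0) \<and> (\<forall>x\<in>carrier G. shift_sum G S g x = \<mu> * g x) \<and>
    (\<forall>H\<in>\<H>. \<forall>x\<in>carrier G. shift_sum G H g x = of_int (c H) * g x)"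
    (is "?P \<H>")
  using assms(1,2)
proof (induction \<H> rule: finite_induct)
  case empty
  then show ?case using assms(4,5) by auto
next
  case (insert K \<H>)
  have "?P \<H>" by (rule insert.IH) (simp add: insert.prems)
  then obtain g c where *: "(\<exists>x\<in>carrier G. g x \<noteq> 0) \<and>
    (\<forall>x\<in>carrier G. shift_sum G S g x = \<mu> * g x) \<and>
    (\<forall>H\<in>\<H>. \<forall>x\<in>carrier G. shift_sum G H g x = of_int (c H) * g x)"
    by (elim exE)
  have g: "\<exists>x\<in>carrier G. g x \<noteq> 0"
    "\<And>x. x \<in> carrier G \<Longrightarrow> shift_sum G S g x = \<mu> * g x"
    "\<And>H x. H \<in> \<H> \<Longrightarrow> x \<in> carrier G \<Longrightarrow> shift_sum G H g x = of_int (c H) * g x"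
    using * by simp_all
  have K: "additive_subgroup K G" and sub: "\<And>H. H \<in> \<H> \<Longrightarrow> H \<subseteq> carrier G"
    using insert.prems by (auto intro: additive_subgroup.a_subset[THEN subsetD])
  note Ksub = additive_subgroup.a_subset[OF K]
  show ?case
  proof (cases "\<forall>x\<in>carrier G. shift_sum G K g x = 0")
    case True
    show ?thesis
      using g True insert.hyps by (intro exI[of _ g] exI[of _ "c(K := 0)"]) auto
  next
    case False
    define h where "h = shift_sum G K g"
    have inherit: "shift_sum G H h x = e * h x"
      if H: "H \<subseteq> carrier G" and eig: "\<And>y. y \<in> carrier G \<Longrightarrow> shift_sum G H g y = e * g y"
        and x: "x \<in> carrier G" for H e x
    proof -
      have "shift_sum G H h x = shift_sum G K (shift_sum G H g) x"
        unfolding h_def by (rule shift_sum_commute[OF H Ksub x])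
      also have "\<dots> = shift_sum G K (\<lambda>y. e * g y) x"
        by (rule shift_sum_cong[OF eig Ksub x])
      finally show ?thesis by (simp add: shift_sum_scale h_def)
    qed
    have hK: "shift_sum G K h x = of_int (int (card K)) * h x" if "x \<in> carrier G" for x
      unfolding h_def using shift_sum_idem[OF K that] by simp
    show ?thesis
    proof (intro exI[of _ h] exI[of _ "c(K := int (card K))"] conjI ballI)
      show "\<exists>x\<in>carrier G. h x \<noteq> 0" using False by (simp add: h_def)
      show "shift_sum G S h x = \<mu> * h x" if "x \<in> carrier G" for x
        by (rule inherit[OF S g(2) that])
      show "shift_sum G H h x = of_int ((c(K := int (card K))) H) * h x"
        if "H \<in> insert K \<H>" "x \<in> carrier G" for H x
        using that hK insert.hyps inherit[OF sub g(3)] by (cases "H = K") auto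
    qed
  qed
qed

text \<open>On a common eigenfunction each subgroup \<open>H\<close> contributes the integer
  \<open>c H\<close> to the sum over \<open>S\<close>, less 1 for the excluded translate by zero.
  Comparing values at one point where \<open>g\<close> is nonzero gives \<mu>.\<close>

lemma eigenvalue_shift_sum_integral:
  assumes \<H>: "finite \<H>" "\<And>H. H \<in> \<H> \<Longrightarrow> additive_subgroup H G" "\<And>H. H \<in> \<H> \<Longrightarrow> finite H"
    and disj: "\<And>H K. H \<in> \<H> \<Longrightarrow> K \<in> \<H> \<Longrightarrow> H \<noteq> K \<Longrightarrow> H \<inter> K \<subseteq> {\<zero>}"
    and S: "S = (\<Union>H\<in>\<H>. H - {\<zero>})"
    and f: "\<exists>x\<in>carrier G. f x \<noteq> 0"
    and eig: "\<And>x. x \<in> carrier G \<Longrightarrow> shift_sum G S f x = \<mu> * f x"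
  shows "\<mu> \<in> \<int>"
proof -
  have sub: "S \<subseteq> carrier G"
    using \<H>(2) unfolding S by (auto intro: additive_subgroup.a_subset[THEN subsetD])
  obtain g c x where g: "x \<in> carrier G" "g x \<noteq> 0" "shift_sum G S g x = \<mu> * g x"
    "\<And>H. H \<in> \<H> \<Longrightarrow> shift_sum G H g x = of_int (c H) * g x"
    using common_eigenfunction[OF \<H>(1,2) sub f eig] by blast
  have "shift_sum G S g x = (\<Sum>H\<in>\<H>. \<Sum>h\<in>H - {\<zero>}. g (x \<oplus> h))"
    unfolding shift_sum_def S using \<H>(1,3) disj by (intro sum.UNION_disjoint) auto
  also have "\<dots> = (\<Sum>H\<in>\<H>. of_int (c H - 1) * g x)"
  proof (rule sum.cong[OF refl])
    fix H assume H: "H \<in> \<H>"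
    have z: "\<zero> \<in> H" using \<H>(2)[OF H] by (rule additive_subgroup.zero_closed)
    have "shift_sum G H g x = g x + (\<Sum>h\<in>H - {\<zero>}. g (x \<oplus> h))"
      unfolding shift_sum_def using sum.remove[OF \<H>(3)[OF H] z, of "\<lambda>h. g (x \<oplus> h)"] g(1) by simp
    then show "(\<Sum>h\<in>H - {\<zero>}. g (x \<oplus> h)) = of_int (c H - 1) * g x"
      using g(4)[OF H] by (simp add: algebra_simps)
  qed
  also have "\<dots> = of_int (\<Sum>H\<in>\<H>. c H - 1) * g x"
    by (simp add: sum_distrib_right)
  finally have "\<mu> * g x = of_int (\<Sum>H\<in>\<H>. c H - 1) * g x" using g(3) by simp
  then have "\<mu> = of_int (\<Sum>H\<in>\<H>. c H - 1)" using g(2) by simp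
  then show ?thesis by (metis Ints_of_int)
qed

end

section \<open>From matrix eigenvectors to eigenfunctions\<close>

lemma (in abelian_group) spectrum_gen_paley:
  assumes vs: "distinct vs" "set vs = carrier G" and R: "kth_powers G k \<subseteq> carrier G"
    and l: "\<mu> \<in> spectrum (adj_mat (gen_paley k G) vs)"
  obtains f where "\<exists>x\<in>carrier G. f x \<noteq> 0"
    "\<And>x. x \<in> carrier G \<Longrightarrow> shift_sum G (kth_powers G k) f x = \<mu> * f x"
proof -
  define n where "n = length vs"
  define S where "S = kth_powers G k"
  let ?A = "adj_mat (gen_paley k G) vs"
  obtain v where v: "v \<in> carrier_vec n" "v \<noteq> 0\<^sub>v n" "?A *\<^sub>v v = \<mu> \<cdot>\<^sub>v v"
    using l by (auto simp: spectrum_def eigenvalue_def eigenvector_def adj_mat_def n_def)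
  have bij: "bij_betw ((!) vs) {..<n} (carrier G)"
    using vs by (simp add: bij_betw_nth n_def)
  \<comment> \<open>The eigenvector is carried along the enumeration \<open>vs\<close> to a function
    on the group; values outside the carrier do not matter.\<close>
  define f where "f = (\<lambda>x. v $ the_inv_into {..<n} ((!) vs) x)"
  have f: "f (vs ! i) = v $ i" if "i < n" for i
    using the_inv_into_f_f[OF bij_betw_imp_inj_on[OF bij]] that by (simp add: f_def)
  have ex: "\<exists>i<n. x = vs ! i" if "x \<in> carrier G" for x
    using that vs by (metis in_set_conv_nth n_def)
  show thesis
  proof
    obtain i where "i < n" "v $ i \<noteq> 0"
      using v(1,2) by (metis carrier_vecD eq_vecI index_zero_vec(1,2))
    moreover have "vs ! i \<in> carrier G" using nth_mem[of i vs] \<open>i < n\<close> vs(2) by (simp add: n_def)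
    ultimately show "\<exists>x\<in>carrier G. f x \<noteq> 0" using f[OF \<open>i < n\<close>] by (intro bexI[of _ "vs ! i"]) auto
  next
    fix x assume x: "x \<in> carrier G"
    then obtain i where i: "i < n" "x = vs ! i" using ex by blast
    have "(?A *\<^sub>v v) $ i = (\<Sum>j<n. if vs ! j \<ominus> x \<in> S then v $ j else 0)"
    proof -
      have "(?A *\<^sub>v v) $ i = (\<Sum>j<n. ?A $$ (i, j) * v $ j)"
        using i(1) v(1) by (simp add: adj_mat_def scalar_prod_def n_def lessThan_atLeast0)
      also have "\<dots> = (\<Sum>j<n. if vs ! j \<ominus> x \<in> S then v $ j else 0)"
      proof (rule sum.cong[OF refl])
        fix j assume "j \<in> {..<n}"
        then have "j < n" by simp
        then have "vs ! j \<in> carrier G" using nth_mem[of j vs] vs(2) by (simp add: n_def)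
        then show "?A $$ (i, j) * v $ j = (if vs ! j \<ominus> x \<in> S then v $ j else 0)"
          using i \<open>j < n\<close> x by (simp add: adj_mat_def gen_paley_def n_def S_def)
      qed
      finally show ?thesis .
    qed
    also have "\<dots> = (\<Sum>j<n. if vs ! j \<ominus> x \<in> S then f (vs ! j) else 0)"
      by (intro sum.cong) (auto simp: f)
    also have "\<dots> = (\<Sum>y\<in>carrier G. if y \<ominus> x \<in> S then f y else 0)"
      by (rule sum.reindex_bij_betw[OF bij])
    also have "\<dots> = (\<Sum>y\<in>{y \<in> carrier G. y \<ominus> x \<in> S}. f y)"
      using vs by (intro sum.inter_filter[symmetric]) (metis finite_set)
    \<comment> \<open>Out-neighbours of \<open>x\<close> are parametrised as
      \<open>x \<oplus> s\<close> with \<open>s\<close> in \<open>S\<close>.\<close>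
    also have "\<dots> = (\<Sum>s\<in>S. f (x \<oplus> s))"
      using x R
      by (intro sum.reindex_bij_witness[of _ "\<lambda>s. x \<oplus> s" "\<lambda>y. y \<ominus> x"])
         (auto simp: S_def minus_eq a_ac r_neg r_neg1 r_neg2 subset_iff)
    finally show "shift_sum G (kth_powers G k) f x = \<mu> * f x"
      using i v(1,3) by (simp add: f shift_sum_def S_def)
  qed
qed

section \<open>Powers in a finite field\<close>

text \<open>The \<open>m\<close>-th power of \<open>[p] \<cdot> \<one>\<close> is the group order
  times \<open>\<one>\<close>, hence zero by Lagrange, and a field has no nilpotents other than
  zero.\<close>

lemma (in field) prime_add_pow_one_eq_zero:
  assumes "finite (carrier R)" and "card (carrier R) = p ^ m"
  shows "[p] \<cdot> \<one> = \<zero>"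
proof -
  have pow: "[(p ^ n)] \<cdot> \<one> = ([p] \<cdot> \<one>) [^] n" for n
  proof (induction n)
    case (Suc n)
    have "[(p ^ Suc n)] \<cdot> \<one> = [p] \<cdot> ([(p ^ n)] \<cdot> \<one>)"
      by (simp add: add.nat_pow_pow mult.commute)
    also have "\<dots> = ([(p ^ n)] \<cdot> \<one>) \<otimes> ([p] \<cdot> \<one>)"
      by (simp add: add_pow_rdistr)
    finally show ?case using Suc by simp
  qed simp
  have "[(order R)] \<cdot> \<one> = \<zero>"
    using add.pow_order_eq_1[of \<one>] by (simp add: order_def)
  then have "([p] \<cdot> \<one>) [^] m = \<zero>" using pow assms(2) by (simp add: order_def)
  then show ?thesis
    by (induction m) (auto simp: integral_iff)
qed

text \<open>The multiplicative group is cyclic of order \<open>card (carrier R) - 1\<close>. For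
  \<open>u = g [^] i\<close> with a generator \<open>g\<close>, this order divides
  \<open>i * n\<close>; as \<open>k * n\<close> divides the order, \<open>k\<close> divides
  \<open>i\<close>.\<close>

lemma (in field) root_of_unity_in_kth_powers:
  assumes fin: "finite (carrier R)" and u: "u \<in> carrier R" "u [^] n = \<one>"
    and n: "n > 0" and dvd: "k * n dvd card (carrier R) - 1"
  shows "u \<in> kth_powers R k"
proof -
  interpret M: group "mult_of R" by (rule field_mult_group)
  obtain g where g: "g \<in> carrier (mult_of R)"
    "carrier (mult_of R) = {g [^] i | i::nat. i \<in> UNIV}"
    using finite_field_mult_group_has_gen[OF fin] by blast
  have finM: "finite (carrier (mult_of R))" using fin by simp
  have pow: "x [^]\<^bsub>mult_of R\<^esub> i = x [^] i" for x and i :: nat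
    by (simp add: nat_pow_mult_of)
  have "M.ord g = card (generate (mult_of R) {g})" by (rule M.generate_pow_card[OF g(1)])
  also have "generate (mult_of R) {g} = carrier (mult_of R)"
  proof -
    have "generate (mult_of R) {g} = {g [^]\<^bsub>mult_of R\<^esub> i | i. i \<in> (UNIV :: nat set)}"
      by (rule M.generate_pow_on_finite_carrier[OF finM g(1)])
    then show ?thesis using g(2) pow by simp
  qed
  also have "card \<dots> = card (carrier R) - 1" using fin by (simp add: card_Diff_singleton)
  finally have ord: "M.ord g = card (carrier R) - 1" .
  have "u \<noteq> \<zero>" using u(2) n nat_pow_zero by (metis zero_not_one not_gr_zero)
  then obtain i :: nat where i: "u = g [^] i" using g(2) u(1) by auto
  have gR: "g \<in> carrier R" "g \<noteq> \<zero>" using g(1) by auto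
  have "g [^]\<^bsub>mult_of R\<^esub> (i * n) = \<one>\<^bsub>mult_of R\<^esub>"
    using u(2) gR by (simp add: i pow nat_pow_pow)
  then have "M.ord g dvd i * n" using M.pow_eq_id[OF g(1)] by blast
  then have "k * n dvd i * n" using ord dvd by (metis dvd_trans)
  then have "k dvd i" using n by simp
  then obtain j where "i = j * k" by (metis dvdE mult.commute)
  then have "u = (g [^] j) [^] k" using gR by (simp add: i nat_pow_pow)
  moreover have "g [^] j \<in> carrier R - {\<zero>}"
    using gR M.nat_pow_closed[OF g(1), of j] pow by simp
  ultimately show ?thesis unfolding kth_powers_def by blast
qed

lemma (in field) kth_powers_mult_closed:
  assumes "x \<in> kth_powers R k" "y \<in> kth_powers R k"
  shows "x \<otimes> y \<in> kth_powers R k"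
proof -
  obtain a b where ab: "a \<in> carrier R - {\<zero>}" "b \<in> carrier R - {\<zero>}" "x = a [^] k" "y = b [^] k"
    using assms unfolding kth_powers_def by blast
  then have "x \<otimes> y = (a \<otimes> b) [^] k" "a \<otimes> b \<in> carrier R - {\<zero>}"
    by (auto simp: nat_pow_distrib integral_iff)
  then show ?thesis unfolding kth_powers_def by blast
qed

lemma (in field) kth_powers_subset: "kth_powers R k \<subseteq> carrier R - {\<zero>}"
proof -
  have "a [^] k \<noteq> \<zero>" if "a \<in> carrier R" "a \<noteq> \<zero>" for a
    using that by (induction k) (auto simp: integral_iff)
  then show ?thesis unfolding kth_powers_def by auto
qed

section \<open>Lines over the prime field\<close>

context field
begin

text \<open>In characteristic \<open>p\<close> this is the line through \<open>s\<close> over the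
  prime field; natural multipliers already include the negatives.\<close>

definition add_span :: "'a \<Rightarrow> 'a set" where
  "add_span s = {[n] \<cdot> s | n::nat. True}"

context
  fixes p :: nat
  assumes p: "prime p" and char: "[p] \<cdot> \<one> = \<zero>"
begin

lemma add_pow_char: "s \<in> carrier R \<Longrightarrow> [p] \<cdot> s = \<zero>"
  using add_pow_ldistr[of \<one> s p] char by simp

lemma add_pow_char_mult: "s \<in> carrier R \<Longrightarrow> [(p * n)] \<cdot> s = \<zero>"
  using add.nat_pow_pow[of s p n] add_pow_char by (simp add: mult.commute)

lemma add_pow_cong:
  assumes s: "s \<in> carrier R" and "[n = m] (mod p)"
  shows "[n] \<cdot> s = [m] \<cdot> s"
proof -
  have "[n] \<cdot> s = [(n mod p)] \<cdot> s" for n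
  proof -
    have "[n] \<cdot> s = [(p * (n div p) + n mod p)] \<cdot> s" by simp
    also have "\<dots> = [(p * (n div p))] \<cdot> s \<oplus> [(n mod p)] \<cdot> s"
      by (rule add.nat_pow_mult[symmetric]) (use s in simp)
    finally show ?thesis using s by (simp add: add_pow_char_mult)
  qed
  then show ?thesis using assms(2) unfolding cong_def by metis
qed

lemma additive_subgroup_add_span:
  assumes s: "s \<in> carrier R"
  shows "additive_subgroup (add_span s) R"
proof (intro additive_subgroupI add.subgroupI)
  show "add_span s \<subseteq> carrier R" "add_span s \<noteq> {}"
    using s unfolding add_span_def by auto
next
  fix x assume "x \<in> add_span s"
  then obtain n :: nat where n: "x = [n] \<cdot> s" unfolding add_span_def by blast
  \<comment> \<open>The multiplier \<open>n * (p - 1)\<close> yields the negative, because it adds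
    up with \<open>n\<close> to a multiple of \<open>p\<close>.\<close>
  have "[n] \<cdot> s \<oplus> [(n * (p - 1))] \<cdot> s = [(n + n * (p - 1))] \<cdot> s"
    by (rule add.nat_pow_mult) (use s in simp)
  also have "n + n * (p - 1) = p * n"
    using prime_gt_0_nat[OF p] by (cases p) simp_all
  finally have "\<ominus> x = [(n * (p - 1))] \<cdot> s"
    using s add_pow_char_mult by (intro minus_equality) (simp_all add: n a_comm)
  then show "\<ominus> x \<in> add_span s"
    unfolding add_span_def by blast
next
  fix x y assume "x \<in> add_span s" "y \<in> add_span s"
  then obtain n m :: nat where "x = [n] \<cdot> s" "y = [m] \<cdot> s" unfolding add_span_def by blast
  then have "x \<oplus> y = [(n + m)] \<cdot> s" using s by (simp add: add.nat_pow_mult)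
  then show "x \<oplus> y \<in> add_span s" unfolding add_span_def by auto
qed

text \<open>A nonzero common element is \<open>[n] \<cdot> s\<close> with \<open>n\<close>
  invertible modulo \<open>p\<close>, so \<open>s\<close> is a multiple of it and lies on the other
  line. By symmetry, distinct lines meet only in zero.\<close>

lemma add_span_subset_of_common:
  assumes s: "s \<in> carrier R" "s' \<in> carrier R"
    and x: "x \<in> add_span s" "x \<in> add_span s'" "x \<noteq> \<zero>"
  shows "add_span s \<subseteq> add_span s'"
proof -
  obtain n m :: nat where n: "x = [n] \<cdot> s" and m: "x = [m] \<cdot> s'"
    using x unfolding add_span_def by blast
  have "\<not> p dvd n"
    using x(3) n s add_pow_char_mult by (auto elim!: dvdE)
  then have "coprime n p" using prime_imp_coprime[OF p] coprime_commute by blast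
  then obtain n' where n': "[n * n' = 1] (mod p)"
    using cong_solve_coprime_nat[of n p] by auto
  have "s = [(n * n')] \<cdot> s" using add_pow_cong[OF s(1) n'] s(1) by simp
  also have "\<dots> = [n'] \<cdot> x" using s(1) n by (simp add: add.nat_pow_pow)
  also have "\<dots> = [(m * n')] \<cdot> s'" using s(2) m by (simp add: add.nat_pow_pow)
  finally have "s = [(m * n')] \<cdot> s'" .
  then have "[i] \<cdot> s = [(m * n' * i)] \<cdot> s'" for i
    using s(2) by (metis add.nat_pow_pow)
  then show ?thesis unfolding add_span_def by blast
qed

text \<open>A nonzero multiple of \<open>s\<close> is \<open>s\<close> times
  \<open>[n] \<cdot> \<one>\<close>. By Fermat this factor is a root of unity of exponent
  \<open>p - 1\<close>, so the divisibility hypothesis makes it a \<open>k\<close>-th power.\<close>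

lemma add_span_subset_kth_powers:
  assumes fin: "finite (carrier R)" and dvd: "k * (p - 1) dvd card (carrier R) - 1"
    and s: "s \<in> kth_powers R k"
  shows "add_span s - {\<zero>} \<subseteq> kth_powers R k"
proof
  fix x assume "x \<in> add_span s - {\<zero>}"
  then obtain n :: nat where x: "x = [n] \<cdot> s" "x \<noteq> \<zero>" unfolding add_span_def by blast
  have sR: "s \<in> carrier R" using s kth_powers_subset by blast
  have "\<not> p dvd n" using x sR add_pow_char_mult by (auto elim!: dvdE)
  have pow: "([n] \<cdot> \<one>) [^] i = [(n ^ i)] \<cdot> \<one>" for i
  proof (induction i)
    case (Suc i)
    then show ?case
      by (simp add: add_pow_rdistr add.nat_pow_pow mult.commute)
  qed simp
  have "[(n ^ (p - 1))] \<cdot> \<one> = [(1::nat)] \<cdot> \<one>"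
    by (rule add_pow_cong[OF one_closed fermat_theorem[OF p \<open>\<not> p dvd n\<close>]])
  then have "([n] \<cdot> \<one>) [^] (p - 1) = \<one>" by (simp add: pow)
  then have "[n] \<cdot> \<one> \<in> kth_powers R k"
    using prime_gt_1_nat[OF p] dvd by (intro root_of_unity_in_kth_powers[OF fin]) auto
  moreover have "x = ([n] \<cdot> \<one>) \<otimes> s" using sR x(1) by (simp add: add_pow_ldistr)
  ultimately show "x \<in> kth_powers R k" using kth_powers_mult_closed s by simp
qed

end

theorem integral_spectrum_gen_paley:
  assumes p: "prime p" and fin: "finite (carrier R)" and card: "card (carrier R) = p ^ m"
    and dvd: "k * (p - 1) dvd card (carrier R) - 1"
  shows "integral_spectrum (gen_paley k R)"
proof -
  note char = prime_add_pow_one_eq_zero[OF fin card]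
  define S where "S = kth_powers R k"
  have S: "S \<subseteq> carrier R - {\<zero>}" unfolding S_def by (rule kth_powers_subset)
  \<comment> \<open>Taking the image as a set counts a line once, although many elements of
    \<open>S\<close> span it.\<close>
  define \<H> where "\<H> = add_span ` S"
  have sub: "additive_subgroup H R" if "H \<in> \<H>" for H
    using that S additive_subgroup_add_span[OF p char] unfolding \<H>_def by blast
  have self: "s \<in> add_span s" if "s \<in> carrier R" for s
    unfolding add_span_def
    using add.nat_pow_eone[of s] that by (metis (mono_tags, lifting) mem_Collect_eq)
  have "\<mu> \<in> \<int>" if vs: "distinct vs" "set vs = carrier R"
    and mu: "\<mu> \<in> spectrum (adj_mat (gen_paley k R) vs)" for vs \<mu>
  proof -
    obtain f where f: "\<exists>x\<in>carrier R. f x \<noteq> 0"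
      "\<And>x. x \<in> carrier R \<Longrightarrow> shift_sum R S f x = \<mu> * f x"
      using spectrum_gen_paley[OF vs _ mu] S unfolding S_def by blast
    show ?thesis
    proof (rule eigenvalue_shift_sum_integral[of \<H> S f \<mu>])
      show "finite \<H>" unfolding \<H>_def using fin S finite_subset by blast
      show "finite H" if "H \<in> \<H>" for H
        using additive_subgroup.a_subset[OF sub[OF that]] fin finite_subset by blast
      show "H \<inter> K \<subseteq> {\<zero>}" if "H \<in> \<H>" "K \<in> \<H>" "H \<noteq> K" for H K
        using that S add_span_subset_of_common[OF p char] unfolding \<H>_def by blast
      show "S = (\<Union>H\<in>\<H>. H - {\<zero>})"
      proof
        show "S \<subseteq> (\<Union>H\<in>\<H>. H - {\<zero>})" unfolding \<H>_def using self S by blast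
        show "(\<Union>H\<in>\<H>. H - {\<zero>}) \<subseteq> S"
          using add_span_subset_kth_powers[OF p char fin dvd] unfolding \<H>_def S_def by blast
      qed
    qed (use sub f in auto)
  qed
  then show ?thesis
    unfolding integral_spectrum_def by (auto simp: fin gen_paley_def)
qed

end

section \<open>Divisibility and cyclotomic values\<close>

text \<open>Modulo \<open>p ^ d - 1\<close> the power \<open>p ^ d\<close> is 1, hence so is its
  \<open>t\<close>-th power. For \<open>p = 0\<close> truncated subtraction makes both sides
  0.\<close>

lemma power_minus_one_dvd_power_mult_minus_one:
  "(p::nat) ^ d - 1 dvd p ^ (d * t) - 1"
proof (cases "p = 0")
  case False
  have "[(p ^ d) ^ t = 1 ^ t] (mod (p ^ d - 1))"
    using False by (intro cong_pow) (simp add: cong_altdef_nat)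
  then show ?thesis
    using False by (simp add: cong_altdef_nat power_mult)
qed (cases "d = 0"; cases "t = 0"; simp add: power_0_left)

lemma power_minus_one_eq_geometric_sum:
  assumes "(p::nat) \<ge> 1"
  shows "p ^ n - 1 = (p - 1) * (\<Sum>i<n. p ^ i)"
proof -
  have "int (p ^ n - 1) = int ((p - 1) * (\<Sum>i<n. p ^ i))"
    using assms power_diff_1_eq[of "int p" n] by (simp add: of_nat_diff)
  then show ?thesis by linarith
qed

text \<open>Modulo \<open>k\<close> the geometric sum consists of \<open>k\<close> terms equal to 1,
  so it vanishes; the other factor of \<open>p ^ k - 1\<close> is \<open>p - 1\<close>.\<close>

lemma mult_dvd_power_minus_one_if_dvd_pred:
  assumes "(p::nat) \<ge> 1" and "k dvd p - 1"
  shows "k * (p - 1) dvd p ^ k - 1"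
proof -
  have "[p = 1] (mod k)" using assms by (simp add: cong_altdef_nat)
  then have "[(\<Sum>i<k. p ^ i) = (\<Sum>i<k. 1 ^ i)] (mod k)"
    by (intro cong_sum cong_pow)
  then have "k dvd (\<Sum>i<k. p ^ i)" by (simp add: cong_0_iff cong_def mod_0_imp_dvd)
  then show ?thesis
    using power_minus_one_eq_geometric_sum[OF assms(1), of k] by (metis mult.commute mult_dvd_mono dvd_refl)
qed

lemma mult_dvd_square_minus_one_if_dvd_succ:
  assumes "(p::nat) \<ge> 1" and "k dvd p + 1"
  shows "k * (p - 1) dvd p ^ 2 - 1"
proof -
  have "p ^ 2 - 1 = (p + 1) * (p - 1)" using assms(1)
    by (simp add: power2_eq_square diff_mult_distrib2)
  then show ?thesis using assms(2) by (simp only: mult_dvd_mono dvd_refl)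
qed

text \<open>Euler's theorem gives divisibility by \<open>k\<close>, the geometric sum gives it by
  \<open>p - 1\<close>, and the two are coprime.\<close>

lemma mult_dvd_power_totient_minus_one:
  assumes "(p::nat) \<ge> 1" and "gcd k (p * (p - 1)) = 1"
  shows "k * (p - 1) dvd p ^ totient k - 1"
proof -
  have c: "coprime k p" "coprime k (p - 1)"
    using assms(2) by (simp_all only: flip: coprime_iff_gcd_eq_1) (simp_all only: coprime_mult_right_iff)
  have "k dvd p ^ totient k - 1"
    using euler_theorem[of p k] c(1) assms(1) by (simp add: cong_altdef_nat coprime_commute)
  moreover have "p - 1 dvd p ^ totient k - 1"
    using power_minus_one_eq_geometric_sum[OF assms(1)] by simp
  ultimately show ?thesis using c(2) by (simp add: divides_mult)
qed

section \<open>Integrality of cyclotomic polynomials\<close>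

text \<open>Integrality of the coefficients is inherited by the quotient when one divides by a monic
  polynomial, which gives integrality of cyclotomic polynomials by induction on the divisors.\<close>

lemma int_poly_monic_quotient:
  fixes f g :: "int poly" and h :: "complex poly"
  assumes "lead_coeff g = 1" and "of_int_poly f = of_int_poly g * h"
  shows "\<exists>q. h = of_int_poly q"
proof -
  \<comment> \<open>For a monic divisor, pseudo-division is genuine division with remainder.\<close>
  obtain q r where qr: "pseudo_divmod f g = (q, r)" by fastforce
  have g: "g \<noteq> 0" using assms(1) by auto
  have f: "f = g * q + r" and r: "r = 0 \<or> degree r < degree g"
    using pseudo_divmod[OF g qr] assms(1) by auto
  let ?c = "of_int_poly :: int poly \<Rightarrow> complex poly"
  have eq: "?c g * (h - ?c q) = ?c r"
    using assms(2) f by (simp add: hom_distribs algebra_simps)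
  have "h = ?c q"
  \<comment> \<open>A nonzero difference would force the remainder to have degree at least that of
    \<open>g\<close>.\<close>
  proof (rule ccontr)
    assume "h \<noteq> ?c q"
    then have nz: "h - ?c q \<noteq> 0" "?c g \<noteq> 0" using g by auto
    then have "r \<noteq> 0" using eq by auto
    have "degree (?c r) = degree (?c g) + degree (h - ?c q)"
      using degree_mult_eq[OF nz(2,1)] eq by simp
    then show False using r \<open>r \<noteq> 0\<close> by simp
  qed
  then show ?thesis by blast
qed

lemma lead_coeff_cyclotomic_poly: "lead_coeff (cyclotomic_poly d) = 1"
  unfolding cyclotomic_poly_def by (rule monic_prod) auto

lemma finite_primitive_roots_of_unity: "d > 0 \<Longrightarrow> finite (primitive_roots_of_unity d)"
  using finite_roots_unity[of d, where 'a = complex]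
  by (auto simp: primitive_roots_of_unity_def elim: rev_finite_subset)

text \<open>The remainder \<open>n mod e\<close> is an exponent below \<open>e\<close> that also
  gives 1, so it is 0.\<close>

lemma primitive_roots_of_unity_order_dvd:
  assumes "\<omega> \<in> primitive_roots_of_unity e" "e > 0" "\<omega> ^ n = 1"
  shows "e dvd n"
proof -
  have "\<omega> ^ n = (\<omega> ^ e) ^ (n div e) * \<omega> ^ (n mod e)"
    by (simp flip: power_mult power_add)
  then have "\<omega> ^ (n mod e) = 1"
    using assms(1,3) by (simp add: primitive_roots_of_unity_def)
  moreover have "n mod e < e" using assms(2) by simp
  ultimately have "n mod e = 0"
    using assms(1) by (auto simp: primitive_roots_of_unity_def)
  then show ?thesis by (simp add: mod_0_imp_dvd)
qed

lemma roots_of_unity_eq_Union_primitive: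
  assumes "d > 0"
  shows "{\<omega>::complex. \<omega> ^ d = 1} = (\<Union>e\<in>{e. e dvd d}. primitive_roots_of_unity e)"
proof (intro equalityI subsetI)
  fix \<omega> :: complex assume "\<omega> \<in> {\<omega>. \<omega> ^ d = 1}"
  then have w: "\<omega> ^ d = 1" by simp
  \<comment> \<open>The order of \<omega>: each root is sorted under its exact order, which divides
    \<open>d\<close>.\<close>
  define e where "e = (LEAST e. e > 0 \<and> \<omega> ^ e = 1)"
  have e: "e > 0 \<and> \<omega> ^ e = 1"
    unfolding e_def by (rule LeastI[of _ d]) (use assms w in simp)
  have "\<omega> \<in> primitive_roots_of_unity e"
    using e not_less_Least[of _ "\<lambda>e. e > 0 \<and> \<omega> ^ e = 1"]
    by (auto simp: primitive_roots_of_unity_def e_def)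
  then show "\<omega> \<in> (\<Union>e\<in>{e. e dvd d}. primitive_roots_of_unity e)"
    using primitive_roots_of_unity_order_dvd e w by blast
next
  fix \<omega> assume "\<omega> \<in> (\<Union>e\<in>{e. e dvd d}. primitive_roots_of_unity e)"
  then show "\<omega> \<in> {\<omega>. \<omega> ^ d = 1}"
    by (auto simp: primitive_roots_of_unity_def power_mult elim!: dvdE)
qed

text \<open>Both sides are monic of degree \<open>d\<close> and vanish at the \<open>d\<close>
  distinct roots of unity, so they agree.\<close>

lemma prod_roots_of_unity:
  assumes "d > 0"
  shows "(\<Prod>\<omega>\<in>{\<omega>::complex. \<omega> ^ d = 1}. [:-\<omega>, 1:]) = Polynomial.monom 1 d - 1" (is "?l = ?r")
proof (rule poly_eqI_degree_lead_coeff[of _ d _ "{\<omega>::complex. \<omega> ^ d = 1}"])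
  have fin: "finite {\<omega>::complex. \<omega> ^ d = 1}" by (rule finite_roots_unity) (use assms in simp)
  have card: "card {\<omega>::complex. \<omega> ^ d = 1} = d" by (rule card_roots_unity_eq[OF assms])
  have deg: "degree ?l = d" by (subst degree_prod_eq_sum_degree) (auto simp: card)
  have "lead_coeff ?l = 1" by (rule monic_prod) auto
  then show "Polynomial.coeff ?l d = Polynomial.coeff ?r d" using deg assms by simp
  show "d \<le> card {\<omega>::complex. \<omega> ^ d = 1}" using card by simp
  show "degree ?l \<le> d" using deg by simp
  show "degree ?r \<le> d" by (intro degree_diff_le degree_monom_le) auto
  show "poly ?l z = poly ?r z" if "z \<in> {\<omega>. \<omega> ^ d = 1}" for z
    using that fin by (auto simp: poly_prod poly_monom prod_zero_iff)
qed

text \<open>The roots of unity split into classes by exact order. The classes are disjoint, since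
  two orders of one root divide each other.\<close>

lemma prod_cyclotomic_poly:
  assumes "d > 0"
  shows "(\<Prod>e | e dvd d. cyclotomic_poly e) = Polynomial.monom 1 d - 1"
proof -
  have disj: "primitive_roots_of_unity e \<inter> primitive_roots_of_unity e' = {}"
    if "e > 0" "e' > 0" "e \<noteq> e'" for e e'
  proof (rule ccontr)
    assume "primitive_roots_of_unity e \<inter> primitive_roots_of_unity e' \<noteq> {}"
    then obtain \<omega> where w: "\<omega> \<in> primitive_roots_of_unity e" "\<omega> \<in> primitive_roots_of_unity e'" by blast
    then have "\<omega> ^ e = 1" "\<omega> ^ e' = 1" by (auto simp: primitive_roots_of_unity_def)
    then have "e dvd e'" "e' dvd e" using primitive_roots_of_unity_order_dvd w that by blast+
    then show False using that(3) by (simp add: dvd_antisym)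
  qed
  have pos: "e > 0" if "e dvd d" for e using that assms by (metis dvd_pos_nat)
  have "(\<Prod>e | e dvd d. cyclotomic_poly e) =
      (\<Prod>\<omega>\<in>(\<Union>e\<in>{e. e dvd d}. primitive_roots_of_unity e). [:-\<omega>, 1:])"
    unfolding cyclotomic_poly_def using assms disj pos finite_primitive_roots_of_unity
    by (intro prod.UNION_disjoint[symmetric]) auto
  then show ?thesis
    using prod_roots_of_unity[OF assms] roots_of_unity_eq_Union_primitive[OF assms] by simp
qed

text \<open>By strong induction, \<open>cyclotomic_poly d\<close> is the quotient of an integer
  polynomial by the monic integer product of the factors for proper divisors of
  \<open>d\<close>.\<close>

lemma cyclotomic_poly_integral:
  assumes "d > 0"
  shows "\<exists>f. cyclotomic_poly d = of_int_poly f"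
  using assms
proof (induction d rule: less_induct)
  case (less d)
  let ?c = "of_int_poly :: int poly \<Rightarrow> complex poly"
  let ?D = "{e. e dvd d} - {d}"
  have "\<exists>f. cyclotomic_poly e = ?c f" if "e \<in> ?D" for e
    using that less by (metis DiffD1 DiffD2 dvd_imp_le dvd_pos_nat insertI1 le_neq_implies_less mem_Collect_eq)
  then obtain F where F: "\<And>e. e \<in> ?D \<Longrightarrow> cyclotomic_poly e = ?c (F e)" by metis
  have "?c (Polynomial.monom 1 d - 1) = (\<Prod>e | e dvd d. cyclotomic_poly e)"
    using prod_cyclotomic_poly[OF less.prems] by (simp add: hom_distribs)
  also have "\<dots> = cyclotomic_poly d * (\<Prod>e\<in>?D. cyclotomic_poly e)"
    using less.prems by (intro prod.remove) auto
  also have "(\<Prod>e\<in>?D. cyclotomic_poly e) = ?c (\<Prod>e\<in>?D. F e)"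
    by (simp add: F hom_distribs)
  finally have "?c (Polynomial.monom 1 d - 1) = ?c (\<Prod>e\<in>?D. F e) * cyclotomic_poly d"
    by (simp add: mult.commute)
  moreover have "lead_coeff (\<Prod>e\<in>?D. F e) = 1"
  proof (rule monic_prod)
    fix e assume "e \<in> ?D"
    then show "lead_coeff (F e) = 1"
      using lead_coeff_cyclotomic_poly[of e] F by simp
  qed
  ultimately show ?case by (rule int_poly_monic_quotient[rotated])
qed

section \<open>Cyclotomic values at natural numbers\<close>

lemma prod_poly_cyclotomic:
  assumes "d > 0"
  shows "(\<Prod>e | e dvd d. poly (cyclotomic_poly e) x) = x ^ d - 1"
  using arg_cong[OF prod_cyclotomic_poly[OF assms], of "\<lambda>f. poly f x"]
  by (simp add: poly_prod poly_monom)

text \<open>The value is an integer \<open>z\<close> by integrality of the coefficients. Multiplied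
  by the natural number coming from the proper divisors it gives \<open>p ^ d - 1 > 0\<close>, which
  forces \<open>z > 0\<close>.\<close>

lemma poly_cyclotomic_of_nat:
  fixes p :: nat
  assumes "p \<ge> 2" and "d > 0"
  shows "\<exists>m>0. poly (cyclotomic_poly d) (of_nat p) = of_nat m"
  using assms(2)
proof (induction d rule: less_induct)
  case (less d)
  let ?D = "{e. e dvd d} - {d}"
  have "\<exists>m>0. poly (cyclotomic_poly e) (of_nat p) = of_nat m" if "e \<in> ?D" for e
    using that less by (metis DiffD1 DiffD2 dvd_imp_le dvd_pos_nat insertI1 le_neq_implies_less mem_Collect_eq)
  then obtain M where M: "\<And>e. e \<in> ?D \<Longrightarrow> M e > 0"
    "\<And>e. e \<in> ?D \<Longrightarrow> poly (cyclotomic_poly e) (of_nat p) = of_nat (M e)" by metis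
  obtain f where f: "cyclotomic_poly d = of_int_poly f"
    using cyclotomic_poly_integral[OF less.prems] by blast
  define z where "z = poly f (int p)"
  have z: "poly (cyclotomic_poly d) (of_nat p) = of_int z"
    unfolding f z_def by (metis of_int_hom.poly_map_poly of_int_of_nat_eq)
  have "of_int (int p ^ d - 1) = (\<Prod>e | e dvd d. poly (cyclotomic_poly e) (of_nat p))"
    using prod_poly_cyclotomic[OF less.prems] by simp
  also have "\<dots> = of_int z * (\<Prod>e\<in>?D. poly (cyclotomic_poly e) (of_nat p))"
    using less.prems by (subst prod.remove[of _ d]) (auto simp: z)
  also have "\<dots> = of_int (z * int (\<Prod>e\<in>?D. M e))" by (simp add: M(2))
  finally have "int p ^ d - 1 = z * int (\<Prod>e\<in>?D. M e)" by (simp only: of_int_eq_iff)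
  moreover have "int p ^ d > 1" using assms(1) less.prems by (intro one_less_power) auto
  ultimately have "z * int (\<Prod>e\<in>?D. M e) > 0" by linarith
  moreover have "int (\<Prod>e\<in>?D. M e) \<ge> 0" by (rule of_nat_0_le_iff)
  ultimately have "z > 0" by (simp only: zero_less_mult_iff) linarith
  then show ?case using z by (intro exI[of _ "nat z"]) (auto simp: of_nat_nat)
qed

text \<open>The value for the divisor 1 is \<open>p - 1\<close>; as \<open>d > 1\<close>, the
  divisors \<open>d\<close> and 1 contribute two separate factors of
  \<open>p ^ d - 1\<close>.\<close>

lemma cyclotomic_value_mult_dvd:
  fixes p :: nat
  assumes p: "p \<ge> 2" and d: "d > 1"
  shows "\<exists>m. of_nat m = poly (cyclotomic_poly d) (of_nat p) \<and> m * (p - 1) dvd p ^ d - 1"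
proof -
  have "\<exists>m. poly (cyclotomic_poly e) (of_nat p) = of_nat m" if "e dvd d" for e
    using poly_cyclotomic_of_nat[OF p, of e] that d by (metis dvd_pos_nat gr0I not_one_less_zero)
  then obtain M where M: "\<And>e. e dvd d \<Longrightarrow> poly (cyclotomic_poly e) (of_nat p) = of_nat (M e)"
    by metis
  have "primitive_roots_of_unity 1 = {1}" by (auto simp: primitive_roots_of_unity_def)
  then have "of_nat (M 1) = (of_nat (p - 1) :: complex)"
    using M[of 1] p by (simp add: cyclotomic_poly_def of_nat_diff)
  then have M1: "M 1 = p - 1" by (simp only: of_nat_eq_iff)
  have "(of_nat (p ^ d - 1) :: complex) = of_nat (\<Prod>e | e dvd d. M e)"
    using prod_poly_cyclotomic[of d "of_nat p"] d p by (simp add: M of_nat_diff)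
  then have "p ^ d - 1 = (\<Prod>e | e dvd d. M e)" by (simp only: of_nat_eq_iff)
  also have "\<dots> = M d * (M 1 * (\<Prod>e\<in>{e. e dvd d} - {d} - {1}. M e))"
    using d by (subst prod.remove[of _ d], simp, simp, subst prod.remove[of _ 1]) auto
  finally show ?thesis using M[of d] M1 by (intro exI[of _ "M d"]) (auto simp: mult.assoc[symmetric])
qed

section \<open>Reduction of the four families to one divisibility\<close>

text \<open>Since \<open>q - 1\<close> divides \<open>q ^ t - 1\<close>, so does
  \<open>k * (p - 1)\<close>; multiplying by the quotient \<open>?N\<close> turns this into the
  condition on the order of the field.\<close>

lemma gen_paley_integral_spectrum_if_dvd:
  fixes F :: "('f, 'r) ring_scheme" and p k :: nat
  assumes p: "prime p" and F: "field F" and q: "q = p ^ d"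
    and card: "card (carrier F) = q ^ (a * t)" and dvd: "k * (p - 1) dvd q - 1"
  shows "integral_spectrum (gen_paley (k * ((q ^ (t * a) - 1) div (q ^ t - 1))) F)"
proof -
  interpret field F by (rule F)
  let ?N = "(q ^ (t * a) - 1) div (q ^ t - 1)"
  have "q > 0" using prime_gt_0_nat[OF p] by (simp add: q)
  then have "card (carrier F) > 0" by (simp add: card)
  \<comment> \<open>Infinite sets have cardinality 0, so a positive cardinality yields
    finiteness.\<close>
  then have fin: "finite (carrier F)" by (rule card_ge_0_finite)
  have "k * (p - 1) dvd q ^ t - 1"
    using dvd power_minus_one_dvd_power_mult_minus_one[of q 1 t] by (auto intro: dvd_trans)
  then have "?N * (k * (p - 1)) dvd ?N * (q ^ t - 1)" by (rule mult_dvd_mono[OF dvd_refl])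
  \<comment> \<open>The division in \<open>?N\<close> is exact; if \<open>q ^ t - 1\<close> is 0,
    then both sides are 0.\<close>
  also have "?N * (q ^ t - 1) = card (carrier F) - 1"
    using power_minus_one_dvd_power_mult_minus_one[of q t a] by (simp add: card mult.commute)
  finally have "k * ?N * (p - 1) dvd card (carrier F) - 1" by (simp only: ac_simps)
  moreover have "card (carrier F) = p ^ (d * (a * t))" by (simp add: card q power_mult)
  ultimately show ?thesis by (rule integral_spectrum_gen_paley[OF p fin, rotated])
qed

theorem theorem5p16:
  fixes p k :: nat
  assumes "prime p" and "k \<ge> 1"
  shows
    "(k dvd p - 1 \<longrightarrow>
        (\<forall>(a::nat) (t::nat) (q::nat) (F :: 'f ring).
           a \<ge> 1 \<and> t \<ge> 1 \<and> q = p ^ k \<and> field F \<and> card (carrier F) = q ^ (a * t) \<longrightarrow>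
           integral_spectrum (gen_paley (k * ((q ^ (t * a) - 1) div (q ^ t - 1))) F)))
   \<and> (k dvd p + 1 \<longrightarrow>
        (\<forall>(a::nat) (t::nat) (q::nat) (F :: 'f ring).
           a \<ge> 1 \<and> t \<ge> 1 \<and> q = p ^ 2 \<and> field F \<and> card (carrier F) = q ^ (a * t) \<longrightarrow>
           integral_spectrum (gen_paley (k * ((q ^ (t * a) - 1) div (q ^ t - 1))) F)))
   \<and> (gcd k (p * (p - 1)) = 1 \<longrightarrow>
        (\<forall>(a::nat) (t::nat) (q::nat) (F :: 'f ring).
           a \<ge> 1 \<and> t \<ge> 1 \<and> q = p ^ totient k \<and> field F \<and> card (carrier F) = q ^ (a * t) \<longrightarrow>
           integral_spectrum (gen_paley (k * ((q ^ (t * a) - 1) div (q ^ t - 1))) F)))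
   \<and> (\<forall>d::nat. d > 1 \<longrightarrow>
        (\<exists>m::nat. of_nat m = poly (cyclotomic_poly d) (of_nat p) \<and>
          (\<forall>(a::nat) (t::nat) (q::nat) (F :: 'f ring).
             a \<ge> 1 \<and> t \<ge> 1 \<and> q = p ^ d \<and> field F \<and> card (carrier F) = q ^ (a * t) \<longrightarrow>
             integral_spectrum (gen_paley (m * ((q ^ (t * a) - 1) div (q ^ t - 1))) F))))"
proof -
  have p: "p \<ge> 1" "p \<ge> 2" using prime_ge_2_nat[OF \<open>prime p\<close>] by simp_all
  note integral = gen_paley_integral_spectrum_if_dvd[OF \<open>prime p\<close>]
  show ?thesis
  proof (intro conjI impI allI, goal_cases)
    case (1 a t q F)
    then show ?case
      using mult_dvd_power_minus_one_if_dvd_pred[OF p(1)] by (intro integral[of F q k a t]) auto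
  next
    case (2 a t q F)
    then show ?case
      using mult_dvd_square_minus_one_if_dvd_succ[OF p(1)] by (intro integral[of F q 2 a t]) auto
  next
    case (3 a t q F)
    then show ?case
      using mult_dvd_power_totient_minus_one[OF p(1)]
      by (intro integral[of F q "totient k" a t]) auto
  next
    \<comment> \<open>The witness \<open>m\<close> is the cyclotomic value at \<open>p\<close>; it
      depends only on \<open>d\<close> and \<open>p\<close> and is fixed before \<open>a\<close>,
      \<open>t\<close> and the field.\<close>
    case (4 d)
    then obtain m where "of_nat m = poly (cyclotomic_poly d) (of_nat p)"
      "m * (p - 1) dvd p ^ d - 1"
      using cyclotomic_value_mult_dvd[OF p(2)] by blast
    then show ?case
      by (intro exI[of _ m] conjI allI impI) (use integral[where d = d] in blast)+
  qed
qed

end
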